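(* Let $\beta=10/9$, $\mu=20/19$, and $0.005<c<1$. For $0<x<1$ set $$f(x)=\frac{\left(\sum_{n=1}^{\infty}\frac{n^{2}}{n+1}c^{n}x^{n}\right)^{4}}{\left(\frac{x^{2}(1+x^{2})}{(1-x^{2})^{3}}\right)\left(\sum_{n=1}^{\infty}\frac{n^{2}}{(n+1)^{2}}x^{2n}\right)},$$ and define $$B_\beta(c,x)=\frac{11}{(1-x^2)(1-cx/\beta)}+\frac{5}{(1+x^2)(1+cx/\beta)}-\frac{17}{4},$$ $$B_\mu(c,x)=\frac{11}{(1-cx/\mu)(1-x^2)}+\frac{8}{(1+cx/\mu)(1+x^2)}-7.$$ Let $$I_\beta(c)=\begin{cases}(0.0045,\,0.9c), & 0.005<c<0.5,\\ (0.0045,\,0.48^2/(c\mu)], & 0.5\le c<1,\end{cases}\qquad I_\mu(c)=\left(0.48^2/(c\mu),\,0.95c\right).$$ Then: (i) for every $x\in I_\beta(c)$, $(\log f)'(x)>(c/\beta-x)\,B_\beta(c,x)>0$; (ii) if $0.5\le c<1$, then for every $x\in I_\mu(c)$, $(\log f)'(x)>(c/\mu-x)\,B_\mu(c,x)>0$. Consequently, $f$ is strictly increasing on $(0.0045,\,0.9c)$ if $0.005<c<0.5$, and on $(0.0045,\,0.95c)$ if $0.5\le c<1$.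
   Context: Here $c$ is a fixed real parameter, $f$ is a function of the real variable $x$ (depending on $c$), $\log$ is the natural logarithm, and the prime denotes the derivative with respect to $x$. All the series converge for $0<x<1$, $0<c<1$, and $f>0$ there. *)

theory Defs
  imports "HOL-Analysis.Analysis"
begin

definition beta :: real where
  "beta = 10 / 9"

definition mu :: real where
  "mu = 20 / 19"

text \<open>The series over \<open>n \<ge> 1\<close> are written with the index shifted to \<open>Suc n\<close>.\<close>

definition numer_series :: "real \<Rightarrow> real \<Rightarrow> real" where
  "numer_series c x =
     (\<Sum>n. (real (Suc n))^2 / (real (Suc n) + 1) * c ^ Suc n * x ^ Suc n)"

definition denom_series :: "real \<Rightarrow> real" where
  "denom_series x =
     (\<Sum>n. (real (Suc n))^2 / (real (Suc n) + 1)^2 * x ^ (2 * Suc n))"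

text \<open>Only the values at \<open>0 < x < 1\<close> and \<open>0 < c < 1\<close> are meaningful.\<close>

definition f :: "real \<Rightarrow> real \<Rightarrow> real" where
  "f c x = (numer_series c x)^4 /
     ((x^2 * (1 + x^2) / (1 - x^2)^3) * denom_series x)"

definition B_beta :: "real \<Rightarrow> real \<Rightarrow> real" where
  "B_beta c x = 11 / ((1 - x^2) * (1 - c * x / beta))
              + 5 / ((1 + x^2) * (1 + c * x / beta)) - 17 / 4"

definition B_mu :: "real \<Rightarrow> real \<Rightarrow> real" where
  "B_mu c x = 11 / ((1 - c * x / mu) * (1 - x^2))
            + 8 / ((1 + c * x / mu) * (1 + x^2)) - 7"

definition I_beta :: "real \<Rightarrow> real set" where
  "I_beta c = (if c < 0.5 then {0.0045 <..< 0.9 * c}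
               else {0.0045 <.. 0.48^2 / (c * mu)})"

definition I_mu :: "real \<Rightarrow> real set" where
  "I_mu c = {0.48^2 / (c * mu) <..< 0.95 * c}"

end

theory Submission
  imports Defs
begin

text \<open>
  Put \<open>t = c x\<close>, \<open>y = x\<^sup>2\<close> and \<open>s = t / \<beta>\<close> (or \<open>s = t / \<mu>\<close>). Since \<open>x (c / \<beta> - x) = s - y\<close> and
  \<open>(s - y) / ((1 - s) (1 - y)) = 1 / (1 - s) - 1 / (1 - y)\<close>, both sides of the claimed
  inequality, multiplied by \<open>x\<close>, are a function of \<open>t\<close> minus a function of \<open>y\<close>. Hence
  it suffices to separate the two one-variable functions by a constant (\<open>-2\<close> for \<open>\<beta>\<close> and
  \<open>1\<close> for \<open>\<mu>\<close>). After clearing denominators each of these four inequalities says that an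
  explicit power series is positive. Its coefficients are nonnegative from some index on, and
  the remaining polynomial is bounded below by Horner evaluation on a few subintervals.
\<close>

section \<open>Power series with linearly bounded coefficients\<close>

definition numer_coeff :: "nat \<Rightarrow> real" where
  "numer_coeff n = (real n)\<^sup>2 / (real n + 1)"

definition denom_coeff :: "nat \<Rightarrow> real" where
  "denom_coeff n = (real n)\<^sup>2 / (real n + 1)\<^sup>2"

definition power_series :: "(nat \<Rightarrow> real) \<Rightarrow> real \<Rightarrow> real" where
  "power_series a t = (\<Sum>n. a n * t ^ n)"

text \<open>The Euler operator \<open>t * d/dt\<close> applied to \<open>power_series a\<close>.
  Unlike the plain derivative it keeps the powers of \<open>t\<close> aligned, so the two series
  combine coefficientwise.\<close>

definition euler_series :: "(nat \<Rightarrow> real) \<Rightarrow> real \<Rightarrow> real" where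
  "euler_series a t = (\<Sum>n. real n * a n * t ^ n)"

text \<open>
  The coefficients of \<open>k (1 - \<sigma> t\<^sup>2) t a'(t) - (r0 + r1 t + r2 t\<^sup>2 + r3 t\<^sup>3) a(t)\<close>. The truncated
  subtraction in the indices is harmless because it is only used when \<open>a 0 = 0\<close>.
\<close>
definition combined_coeff ::
  "(nat \<Rightarrow> real) \<Rightarrow> real \<Rightarrow> real \<Rightarrow> real \<Rightarrow> real \<Rightarrow> real \<Rightarrow> real \<Rightarrow> nat \<Rightarrow> real" where
  "combined_coeff a k \<sigma> r0 r1 r2 r3 n =
     k * (real n * a n - \<sigma> * (real (n - 2) * a (n - 2)))
     - (r0 * a n + r1 * a (n - 1) + r2 * a (n - 2) + r3 * a (n - 3))"

text \<open>Comparison with the differentiated geometric series. The linear bound also forces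
  \<open>a 0 = 0\<close>, on which the later index shifts rely.\<close>

lemma summable_linear_coeff:
  fixes a :: "nat \<Rightarrow> real"
  assumes "\<And>n. \<bar>a n\<bar> \<le> real n" and "\<bar>t\<bar> < 1"
  shows "summable (\<lambda>n. a n * t ^ n)"
proof (rule summable_comparison_test')
  have "summable (\<lambda>n. diffs (\<lambda>_. 1) n * \<bar>t\<bar> ^ n)"
    by (rule termdiff_converges[where K = 1]) (use assms in \<open>auto simp: summable_geometric\<close>)
  then show "summable (\<lambda>n. real (Suc n) * \<bar>t\<bar> ^ n)"
    by (simp add: diffs_def)
next
  fix n :: nat
  have "\<bar>a n\<bar> \<le> real (Suc n)"
    using assms(1)[of n] by simp
  then show "norm (a n * t ^ n) \<le> real (Suc n) * \<bar>t\<bar> ^ n"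
    by (simp add: abs_mult power_abs mult_right_mono del: of_nat_Suc)
qed

lemma power_series_sums:
  assumes "\<And>n. \<bar>a n\<bar> \<le> real n" and "\<bar>t\<bar> < 1"
  shows "(\<lambda>n. a n * t ^ n) sums power_series a t"
  unfolding power_series_def using summable_linear_coeff[OF assms] by (rule summable_sums)

lemma euler_series_sums_and_deriv:
  assumes a: "\<And>n. \<bar>a n\<bar> \<le> real n" and t: "\<bar>t\<bar> < 1" "t \<noteq> 0"
  shows "(\<lambda>n. real n * a n * t ^ n) sums euler_series a t"
    and "(power_series a has_real_derivative euler_series a t / t) (at t)"
proof -
  let ?D = "\<Sum>n. diffs a n * t ^ n"
  have "summable (\<lambda>n. diffs a n * t ^ n)"
    by (rule termdiff_converges[where K = 1]) (use a t in \<open>auto intro: summable_linear_coeff\<close>)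
  from sums_mult[OF diffs_equiv[OF this], of t]
  have "(\<lambda>n. t * (real n * a n * t ^ (n - Suc 0))) sums (t * ?D)" .
  \<comment> \<open>At \<open>n = 0\<close> the truncated exponent is harmless because the factor
    \<open>real n\<close> vanishes.\<close>
  moreover have "t * (real n * a n * t ^ (n - Suc 0)) = real n * a n * t ^ n" for n
    by (cases n) auto
  ultimately have sums: "(\<lambda>n. real n * a n * t ^ n) sums (t * ?D)"
    by simp
  then have eq: "euler_series a t = t * ?D"
    by (simp add: euler_series_def sums_iff)
  with sums show "(\<lambda>n. real n * a n * t ^ n) sums euler_series a t"
    by simp
  have "(power_series a has_real_derivative ?D) (at t)"
    unfolding power_series_def
    \<comment> \<open>The midpoint of \<bar>t\<bar> and 1 serves as a radius strictly between
      them.\<close>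
    by (rule termdiffs_strong[where K = "(1 + \<bar>t\<bar>) / 2"])
      (use a t in \<open>auto intro: summable_linear_coeff\<close>)
  then show "(power_series a has_real_derivative euler_series a t / t) (at t)"
    using eq t by simp
qed

text \<open>Multiplication by \<open>t ^ k\<close> moves every coefficient up by \<open>k\<close>;
  the new terms of index below \<open>k\<close> all read \<open>a 0\<close>, which is zero.\<close>

lemma sums_coeff_shift:
  fixes a :: "nat \<Rightarrow> real"
  assumes "a 0 = 0" and "(\<lambda>n. a n * t ^ n) sums S"
  shows "(\<lambda>n. a (n - k) * t ^ n) sums (t ^ k * S)"
proof -
  have "(\<lambda>n. a (n + k - k) * t ^ (n + k)) sums (t ^ k * S)"
    using sums_mult[OF assms(2), of "t ^ k"] by (simp add: power_add mult_ac)
  then show ?thesis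
    by (subst (asm) sums_zero_iff_shift[of k "\<lambda>n. a (n - k) * t ^ n"]) (use assms(1) in auto)
qed

lemma combined_coeff_sums:
  assumes a: "\<And>n. \<bar>a n\<bar> \<le> real n" and t: "\<bar>t\<bar> < 1" "t \<noteq> 0"
  shows "(\<lambda>n. combined_coeff a k \<sigma> r0 r1 r2 r3 n * t ^ n) sums
    (k * (1 - \<sigma> * t ^ 2) * euler_series a t
     - (r0 + r1 * t + r2 * t ^ 2 + r3 * t ^ 3) * power_series a t)"
proof -
  have a0: "a 0 = 0"
    using a[of 0] by simp
  have S: "(\<lambda>n. a (n - j) * t ^ n) sums (t ^ j * power_series a t)" for j
    by (rule sums_coeff_shift[OF a0 power_series_sums[OF a t(1)]])
  have T: "(\<lambda>n. real (n - j) * a (n - j) * t ^ n) sums (t ^ j * euler_series a t)" for j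
    by (rule sums_coeff_shift[of "\<lambda>n. real n * a n"])
      (use euler_series_sums_and_deriv(1)[OF a t] in auto)
  \<comment> \<open>Writing \<open>n - 0\<close> makes the unshifted series instances of
    \<open>S\<close> and \<open>T\<close> as well.\<close>
  have "(\<lambda>n. k * (real (n - 0) * a (n - 0) * t ^ n - \<sigma> * (real (n - 2) * a (n - 2) * t ^ n))
      - (r0 * (a (n - 0) * t ^ n) + r1 * (a (n - 1) * t ^ n)
         + r2 * (a (n - 2) * t ^ n) + r3 * (a (n - 3) * t ^ n))) sums
    (k * (t ^ 0 * euler_series a t - \<sigma> * (t ^ 2 * euler_series a t))
      - (r0 * (t ^ 0 * power_series a t) + r1 * (t ^ 1 * power_series a t)
         + r2 * (t ^ 2 * power_series a t) + r3 * (t ^ 3 * power_series a t)))"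
    by (intro sums_diff sums_add sums_mult S T)
  \<comment> \<open>\<open>sums_cong\<close> rewrites the summand and \<open>subst\<close> the
    limit; both changes are plain algebra.\<close>
  then show ?thesis
    by (rule sums_cong[THEN iffD1, rotated, THEN subst[where P = "\<lambda>s. _ sums s", rotated]])
      (auto simp: combined_coeff_def algebra_simps)
qed

lemma combined_coeff_partial_sum_le:
  assumes a: "\<And>n. \<bar>a n\<bar> \<le> real n" and t: "0 < t" "t < 1"
    and nonneg: "\<And>n. n \<ge> K \<Longrightarrow> 0 \<le> combined_coeff a k \<sigma> r0 r1 r2 r3 n"
  shows "(\<Sum>n<K. combined_coeff a k \<sigma> r0 r1 r2 r3 n * t ^ n) \<le>
    k * (1 - \<sigma> * t ^ 2) * euler_series a t
     - (r0 + r1 * t + r2 * t ^ 2 + r3 * t ^ 3) * power_series a t"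
proof -
  have s: "(\<lambda>n. combined_coeff a k \<sigma> r0 r1 r2 r3 n * t ^ n) sums
    (k * (1 - \<sigma> * t ^ 2) * euler_series a t
     - (r0 + r1 * t + r2 * t ^ 2 + r3 * t ^ 3) * power_series a t)"
    by (rule combined_coeff_sums) (use assms in auto)
  show ?thesis
    unfolding sums_unique[OF s]
    by (rule sum_le_suminf) (use s nonneg t in \<open>auto simp: sums_iff\<close>)
qed

section \<open>The two series occurring in \<open>f\<close>\<close>

lemma numer_coeff_bound: "\<bar>numer_coeff n\<bar> \<le> real n"
  by (auto simp: numer_coeff_def divide_simps power2_eq_square algebra_simps)

lemma denom_coeff_bound: "\<bar>denom_coeff n\<bar> \<le> real n"
proof -
  have "(real n)\<^sup>2 \<le> (real n + 1)\<^sup>2"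
    by (intro power_mono) auto
  then have "denom_coeff n \<le> 1"
    by (simp add: denom_coeff_def)
  moreover have "0 \<le> denom_coeff n" "n = 0 \<Longrightarrow> denom_coeff n = 0"
    by (auto simp: denom_coeff_def)
  ultimately show ?thesis
    by (cases "n = 0") auto
qed

lemma power_series_pos:
  assumes "\<And>n. \<bar>a n\<bar> \<le> real n" and "\<And>n. 0 \<le> a n" and "0 < a 1" and "0 < t" "t < 1"
  shows "0 < power_series a t"
  unfolding power_series_def
  by (rule suminf_pos2[where i = 1]) (use assms in \<open>auto intro: summable_linear_coeff\<close>)

lemma numer_series_eq:
  assumes "\<bar>c * x\<bar> < 1"
  shows "numer_series c x = power_series numer_coeff (c * x)"
proof -
  have "(\<lambda>n. numer_coeff n * (c * x) ^ n) sums power_series numer_coeff (c * x)"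
    by (rule power_series_sums[OF numer_coeff_bound assms])
  then have "(\<lambda>n. numer_coeff (Suc n) * (c * x) ^ Suc n) sums power_series numer_coeff (c * x)"
    by (subst sums_Suc_iff) (simp add: numer_coeff_def)
  then show ?thesis
    by (simp add: numer_series_def numer_coeff_def sums_iff power_mult_distrib mult.assoc del: power_Suc)
qed

lemma denom_series_eq:
  assumes "\<bar>x\<bar> < 1"
  shows "denom_series x = power_series denom_coeff (x ^ 2)"
proof -
  have "\<bar>x ^ 2\<bar> < 1"
    using assms by (simp add: abs_square_less_1)
  then have "(\<lambda>n. denom_coeff n * (x ^ 2) ^ n) sums power_series denom_coeff (x ^ 2)"
    by (rule power_series_sums[OF denom_coeff_bound])
  then have "(\<lambda>n. denom_coeff (Suc n) * (x ^ 2) ^ Suc n) sums power_series denom_coeff (x ^ 2)"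
    by (subst sums_Suc_iff) (simp add: denom_coeff_def)
  then show ?thesis
    by (simp add: denom_series_def denom_coeff_def sums_iff power_mult[symmetric]
        del: power_Suc mult_Suc_right)
qed

section \<open>Certified lower bounds for polynomials\<close>

text \<open>Interval Horner scheme: a lower bound on \<open>[l, r]\<close>, valid for \<open>0 \<le> l\<close>.\<close>
fun horner_lower :: "real list \<Rightarrow> real \<Rightarrow> real \<Rightarrow> real" where
  "horner_lower [] l r = 0"
| "horner_lower (e # es) l r =
     e + (let h = horner_lower es l r in if 0 \<le> h then l * h else r * h)"

fun horner :: "real list \<Rightarrow> real \<Rightarrow> real" where
  "horner [] t = 0"
| "horner (e # es) t = e + t * horner es t"

text \<open>The sign of the bound \<open>h\<close> for the tail decides which endpoint minimises
  \<open>t * h\<close>; the induction hypothesis and \<open>0 \<le> t\<close> then pass from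
  \<open>h\<close> to the tail itself.\<close>

lemma horner_lower_le:
  assumes "0 \<le> l" "l \<le> t" "t \<le> r"
  shows "horner_lower es l r \<le> horner es t"
proof (induction es)
  case (Cons e es)
  have "(if 0 \<le> h then l * h else r * h) \<le> t * horner es t" if "h = horner_lower es l r" for h
  proof -
    have "(if 0 \<le> h then l * h else r * h) \<le> t * h"
      using assms by (auto intro: mult_right_mono mult_right_mono_neg)
    also have "\<dots> \<le> t * horner es t"
      using Cons that assms by (intro mult_left_mono) auto
    finally show ?thesis .
  qed
  then show ?case
    by (simp add: Let_def)
qed simp


text \<open>The second list holds breakpoints, and neighbours span the subintervals. For concrete
  lists the simplifier evaluates the whole check.\<close>

fun horner_pos_on :: "real list \<Rightarrow> real list \<Rightarrow> bool" where
  "horner_pos_on es (l # r # bs) \<longleftrightarrow> 0 < horner_lower es l r \<and> horner_pos_on es (r # bs)"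
| "horner_pos_on es _ \<longleftrightarrow> True"

text \<open>The recursion walks along the breakpoints to the subinterval containing
  \<open>t\<close>. The bound by \<open>last bs\<close> is strict so that a list with one breakpoint
  is contradictory.\<close>

lemma horner_pos:
  assumes "horner_pos_on es bs" "sorted bs" "bs \<noteq> []" "0 \<le> hd bs" "hd bs \<le> t" "t < last bs"
  shows "0 < horner es t"
  using assms
proof (induction es bs rule: horner_pos_on.induct)
  case (1 es l r bs)
  show ?case
  proof (cases "t \<le> r")
    case True
    with 1 horner_lower_le[of l t r es] show ?thesis
      by auto
  next
    case False
    with 1 show ?thesis
      by auto
  qed
qed auto

section \<open>The logarithmic derivative of f\<close>

text \<open>Since dt/dx = t/x and dy/dx = 2y/x, a common factor 1/x comes out of every term, and the
  chain rule produces Euler series instead of plain derivatives.\<close>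

lemma ln_f_has_derivative:
  assumes c: "0 < c" "c < 1" and x: "0 < x" "x < 1"
  defines "t \<equiv> c * x" and "y \<equiv> x ^ 2"
  shows "((\<lambda>z. ln (f c z)) has_real_derivative
    (4 * (euler_series numer_coeff t / power_series numer_coeff t)
     - 2 * (euler_series denom_coeff y / power_series denom_coeff y)
     - 2 - 2 * y / (1 + y) - 6 * y / (1 - y)) / x) (at x)"
proof (rule has_field_derivative_transform_within_open)
  let ?N = "power_series numer_coeff" and ?D = "power_series denom_coeff"
  \<comment> \<open>The logarithm expanded into a sum. It agrees with \<open>ln (f c z)\<close> on
    the open unit interval, which is enough for the derivative at \<open>x\<close>.\<close>
  let ?g = "\<lambda>z. 4 * ln (?N (c * z)) - (2 * ln z + ln (1 + z ^ 2) - 3 * ln (1 - z ^ 2)) - ln (?D (z ^ 2))"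
  have range: "0 < c * z" "c * z < 1" "0 < z ^ 2" "z ^ 2 < 1" if "z \<in> {0 <..< 1}" for z
    using that c mult_strict_mono[of c 1 z 1] by (auto simp: power_less_one_iff)
  have N: "0 < ?N (c * z)" and D: "0 < ?D (z ^ 2)" if "z \<in> {0 <..< 1}" for z
    using range[OF that]
    by (auto intro!: power_series_pos numer_coeff_bound denom_coeff_bound
        simp: numer_coeff_def denom_coeff_def)
  show "open {0 <..< 1 :: real}" "x \<in> {0 <..< 1}"
    using x by auto
  show "?g z = ln (f c z)" if "z \<in> {0 <..< 1}" for z
  proof -
    have "f c z = ?N (c * z) ^ 4 / ((z ^ 2 * (1 + z ^ 2) / (1 - z ^ 2) ^ 3) * ?D (z ^ 2))"
      using that range[OF that] by (simp add: f_def numer_series_eq denom_series_eq)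
    also have "ln \<dots> = ?g z"
      using that range[OF that] N[OF that] D[OF that] add_pos_pos[OF zero_less_one range(3)[OF that]]
      by (simp add: ln_div ln_mult ln_realpow)
    finally show ?thesis
      by simp
  qed
  have x': "x \<in> {0 <..< 1}"
    using x by simp
  note t = range[OF x']
  have dN: "((\<lambda>z. ?N (c * z)) has_real_derivative euler_series numer_coeff t / t * c) (at x)"
    unfolding t_def
    by (rule DERIV_chain2[OF euler_series_sums_and_deriv(2)[OF numer_coeff_bound]])
      (use t c x in \<open>auto intro!: derivative_eq_intros\<close>)
  have dD: "((\<lambda>z. ?D (z ^ 2)) has_real_derivative euler_series denom_coeff y / y * (2 * x)) (at x)"
    unfolding y_def
    by (rule DERIV_chain2[OF euler_series_sums_and_deriv(2)[OF denom_coeff_bound]])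
      (use t x in \<open>auto intro!: derivative_eq_intros\<close>)
  have "(?g has_real_derivative
      4 * (1 / ?N (c * x) * (euler_series numer_coeff t / t * c))
      - (2 * (1 / x) + 1 / (1 + x ^ 2) * (2 * x) - 3 * (1 / (1 - x ^ 2) * (- 2 * x)))
      - 1 / ?D (x ^ 2) * (euler_series denom_coeff y / y * (2 * x))) (at x)"
  proof (intro DERIV_diff DERIV_add DERIV_cmult)
    show "((\<lambda>z. ln (?N (c * z))) has_real_derivative
        1 / ?N (c * x) * (euler_series numer_coeff t / t * c)) (at x)"
      by (rule DERIV_chain2[OF DERIV_ln_divide dN]) (use N[OF x'] in simp)
    show "((\<lambda>z. ln (?D (z ^ 2))) has_real_derivative
        1 / ?D (x ^ 2) * (euler_series denom_coeff y / y * (2 * x))) (at x)"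
      by (rule DERIV_chain2[OF DERIV_ln_divide dD]) (use D[OF x'] in simp)
    show "(ln has_real_derivative 1 / x) (at x)"
      by (rule DERIV_ln_divide) (use x in simp)
    show "((\<lambda>z. ln (1 + z ^ 2)) has_real_derivative 1 / (1 + x ^ 2) * (2 * x)) (at x)"
      by (rule DERIV_chain2[OF DERIV_ln_divide])
        (use t in \<open>auto intro!: derivative_eq_intros add_pos_pos\<close>)
    show "((\<lambda>z. ln (1 - z ^ 2)) has_real_derivative 1 / (1 - x ^ 2) * (- 2 * x)) (at x)"
      by (rule DERIV_chain2[OF DERIV_ln_divide])
        (use t in \<open>auto intro!: derivative_eq_intros\<close>)
  qed
  moreover have "4 * (1 / ?N (c * x) * (euler_series numer_coeff t / t * c))
      - (2 * (1 / x) + 1 / (1 + x ^ 2) * (2 * x) - 3 * (1 / (1 - x ^ 2) * (- 2 * x)))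
      - 1 / ?D (x ^ 2) * (euler_series denom_coeff y / y * (2 * x)) =
    (4 * (euler_series numer_coeff t / ?N t) - 2 * (euler_series denom_coeff y / ?D y)
     - 2 - 2 * y / (1 + y) - 6 * y / (1 - y)) / x" (is "?lhs = ?rhs")
  proof -
    have "4 * (1 / ?N (c * x) * (euler_series numer_coeff t / t * c)) =
        4 * (euler_series numer_coeff t / ?N t) / x"
      using c x by (simp add: t_def)
    moreover have "1 / ?D (x ^ 2) * (euler_series denom_coeff y / y * (2 * x)) =
        2 * (euler_series denom_coeff y / ?D y) / x"
      using x by (simp add: y_def power2_eq_square)
    moreover have "1 / (1 + x ^ 2) * (2 * x) = 2 * y / (1 + y) / x"
      using x by (simp add: y_def power2_eq_square)
    moreover have "3 * (1 / (1 - x ^ 2) * (- 2 * x)) = - (6 * y / (1 - y)) / x"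
      using x by (simp add: y_def power2_eq_square)
    ultimately show ?thesis
      by (simp add: diff_divide_distrib)
  qed
  ultimately show "(?g has_real_derivative ?rhs) (at x)"
    by metis
qed

section \<open>Coefficientwise proof of the four series inequalities\<close>

lemma horner_eq_sum: "horner es t = (\<Sum>i<length es. es ! i * t ^ i)"
proof (induction es)
  case (Cons e es)
  then show ?case
    by (simp add: sum.lessThan_Suc_shift sum_distrib_left mult_ac del: sum.lessThan_Suc)
qed simp

text \<open>The coefficients of degree 0 and 1 vanish because \<open>a 0 = 0\<close> and
  \<open>r0 = k\<close>, so \<open>t ^ 2\<close> factors out. The list \<open>es\<close> bounds the
  next coefficients from below, the remaining ones are nonnegative, and strictness comes from the
  Horner value.\<close>

lemma combined_series_pos:
  fixes es :: "real list"
  defines "K \<equiv> length es + 2"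
  assumes a: "\<And>n. \<bar>a n\<bar> \<le> real n" and t: "0 < t" "t < 1"
    and "r0 = k"
    and le: "\<And>i. i < length es \<Longrightarrow> es ! i \<le> combined_coeff a k \<sigma> r0 r1 r2 r3 (i + 2)"
    and nonneg: "\<And>n. n \<ge> K \<Longrightarrow> 0 \<le> combined_coeff a k \<sigma> r0 r1 r2 r3 n"
    and horner: "0 < horner es t"
  shows "(r0 + r1 * t + r2 * t ^ 2 + r3 * t ^ 3) * power_series a t <
    k * (1 - \<sigma> * t ^ 2) * euler_series a t"
proof -
  let ?w = "combined_coeff a k \<sigma> r0 r1 r2 r3"
  have "a 0 = 0"
    using a[of 0] by simp
  then have w01: "?w 0 = 0" "?w 1 = 0"
    using \<open>r0 = k\<close> by (simp_all add: combined_coeff_def)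
  have "0 < t ^ 2 * horner es t"
    using t horner by simp
  also have "\<dots> = (\<Sum>i<length es. es ! i * t ^ (i + 2))"
    by (simp add: horner_eq_sum sum_distrib_left power2_eq_square mult_ac)
  also have "\<dots> \<le> (\<Sum>i<length es. ?w (i + 2) * t ^ (i + 2))"
    using le t by (intro sum_mono mult_right_mono) auto
  also have "\<dots> = (\<Sum>n<K. ?w n * t ^ n)"
    using w01 by (simp add: K_def sum.lessThan_Suc_shift del: sum.lessThan_Suc)
  also have "\<dots> \<le> k * (1 - \<sigma> * t ^ 2) * euler_series a t
     - (r0 + r1 * t + r2 * t ^ 2 + r3 * t ^ 3) * power_series a t"
    by (rule combined_coeff_partial_sum_le[OF a t nonneg])
  finally show ?thesis
    by simp
qed

text \<open>From n^2/(n+1) = n - 1 + 1/(n+1). The result is a quadratic in \<open>v\<close> plus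
  inverses, which \<open>linarith\<close> can treat as atoms with known bounds; from
  \<open>n = 3\<close> on the truncated subtractions are exact.\<close>

lemma combined_numer_coeff:
  assumes "n \<ge> 3"
  defines "v \<equiv> real n"
  shows "combined_coeff numer_coeff k \<sigma> r0 r1 r2 r3 n =
    k * (v\<^sup>2 - v + 1 - inverse (v + 1) - \<sigma> * (v\<^sup>2 - 5 * v + 7 - inverse (v - 1)))
    - (r0 * (v - 1 + inverse (v + 1)) + r1 * (v - 2 + inverse v)
       + r2 * (v - 3 + inverse (v - 1)) + r3 * (v - 4 + inverse (v - 2)))"
proof -
  have *: "numer_coeff m = real m - 1 + inverse (real m + 1)"
    "real m * numer_coeff m = (real m)\<^sup>2 - real m + 1 - inverse (real m + 1)" for m
    by (simp_all add: numer_coeff_def field_simps power2_eq_square)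
  have d: "real (n - 1) = v - 1" "real (n - 2) = v - 2" "real (n - 3) = v - 3"
    using assms by (auto simp: of_nat_diff)
  show ?thesis
    unfolding combined_coeff_def *(2) unfolding *(1) d
    by (simp add: v_def algebra_simps power2_eq_square)
qed

text \<open>From n^2/(n+1)^2 = (1 - 1/(n+1))^2, for the same purpose.\<close>

lemma combined_denom_coeff:
  assumes "n \<ge> 3"
  defines "v \<equiv> real n"
  shows "combined_coeff denom_coeff k \<sigma> r0 r1 r2 r3 n =
    k * (v - 2 + 3 * inverse (v + 1) - inverse (v + 1) ^ 2 - \<sigma> * (v - 4 + 3 * inverse (v - 1) - inverse (v - 1) ^ 2))
    - (r0 * (1 - 2 * inverse (v + 1) + inverse (v + 1) ^ 2) + r1 * (1 - 2 * inverse v + inverse v ^ 2)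
       + r2 * (1 - 2 * inverse (v - 1) + inverse (v - 1) ^ 2) + r3 * (1 - 2 * inverse (v - 2) + inverse (v - 2) ^ 2))"
proof -
  have *: "denom_coeff m = 1 - 2 * inverse (real m + 1) + inverse (real m + 1) ^ 2"
    "real m * denom_coeff m = real m - 2 + 3 * inverse (real m + 1) - inverse (real m + 1) ^ 2" for m
  proof -
    have "real m + 1 \<noteq> 0"
      by linarith
    then show "denom_coeff m = 1 - 2 * inverse (real m + 1) + inverse (real m + 1) ^ 2"
      "real m * denom_coeff m = real m - 2 + 3 * inverse (real m + 1) - inverse (real m + 1) ^ 2"
      by (simp_all add: denom_coeff_def divide_simps) (simp_all add: algebra_simps power2_eq_square)
  qed
  have d: "real (n - 1) = v - 1" "real (n - 2) = v - 2" "real (n - 3) = v - 3"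
    using assms by (auto simp: of_nat_diff)
  show ?thesis
    unfolding combined_coeff_def *(2) unfolding *(1) d
    by (simp add: v_def algebra_simps)
qed

text \<open>The cubic is the numerator of 11/(1-s) - 5/(1+s) - 17s/4 - 2 over 1 - s^2, at s =
  t/\<beta> = 9t/10. The coefficient of degree 2 exceeds 1/25 and no later one is negative, so a
  single list entry suffices.\<close>

lemma numer_bound_beta:
  assumes t: "0 < t" "t < 1"
  shows "(4 + 423 / 40 * t + 81 / 50 * t ^ 2 + 12393 / 4000 * t ^ 3) * power_series numer_coeff t <
    4 * (1 - 81 / 100 * t ^ 2) * euler_series numer_coeff t"
proof (rule combined_series_pos[OF numer_coeff_bound t, where es = "[1 / 25]"])
  let ?w = "combined_coeff numer_coeff 4 (81 / 100) 4 (423 / 40) (81 / 50) (12393 / 4000)"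
  show "[1 / 25] ! i \<le> ?w (i + 2)" if "i < length [1 / 25 :: real]" for i
    using that by (simp add: combined_coeff_def numer_coeff_def)
  show "0 \<le> ?w n" if "n \<ge> length [1 / 25 :: real] + 2" for n
  proof (cases "n < 6")
    case True
    with that have "n = 3 \<or> n = 4 \<or> n = 5"
      by auto
    then show ?thesis
      by (elim disjE) (simp_all add: combined_coeff_def numer_coeff_def)
  next
    case False
    then have n: "3 \<le> n" and v: "6 \<le> real n"
      by simp_all
    then have "inverse (real n + 1) \<le> 1 / 7" "inverse (real n) \<le> 1 / 6" "0 \<le> inverse (real n - 1)"
      "inverse (real n - 2) \<le> 1 / 4"
      by (simp_all add: divide_simps)
    \<comment> \<open>The tangent at 6 bounds the square from below by a linear term; the square has
      the positive coefficient \<open>4 * (1 - 81 / 100)\<close>.\<close>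
    moreover have "0 \<le> (real n)\<^sup>2 - 12 * real n + 36"
      using zero_le_power2[of "real n - 6"] by (simp add: power2_diff algebra_simps)
    ultimately show ?thesis
      using v unfolding combined_numer_coeff[OF n] ring_distribs by linarith
  qed
qed (use t in auto)

text \<open>
  Here and below the list \<open>es\<close> holds the coefficients from degree \<open>2\<close> on, rounded down to three
  decimals, and the list \<open>bs\<close> is a partition fine enough for the interval Horner bounds. The lower
  limit \<open>0.21888 = 0.48\<^sup>2 / \<mu>\<close> is essential: the polynomial changes sign near \<open>0.215\<close>.
\<close>
lemma numer_bound_mu:
  assumes t: "0.21888 \<le> t" "t < 0.95"
  shows "(4 + 57 / 5 * t + (- 361 / 400) * t ^ 2 + 48013 / 8000 * t ^ 3) * power_series numer_coeff t <
    4 * (1 - 361 / 400 * t ^ 2) * euler_series numer_coeff t"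
proof -
  let ?w = "combined_coeff numer_coeff 4 (361 / 400) 4 (57 / 5) (- 361 / 400) (48013 / 8000)"
  let ?es = "[-367/1000, 1446/1000, 1325/1000, -153/1000, -1467/1000, -2282/1000, -2474/1000,
    -1984/1000, -779/1000, 1159/1000, 3844/1000, 7282/1000] :: real list"
  let ?bs = "[21888/100000, 2972/10000, 5644/10000, 6906/10000, 7449/10000, 7791/10000,
    8076/10000, 8448/10000, 912/1000, 95/100] :: real list"
  show ?thesis
  proof (rule combined_series_pos[OF numer_coeff_bound, where es = ?es])
    show "0 < t" "t < 1"
      using t by auto
    show "?es ! i \<le> ?w (i + 2)" if "i < length ?es" for i
    proof -
      have "i \<in> set [0..<12]"
        using that by simp
      then show ?thesis
        by (simp add: upt_rec combined_coeff_def numer_coeff_def del: set_upt)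
          (elim disjE, simp_all)
    qed
    show "0 \<le> ?w n" if "n \<ge> length ?es + 2" for n
    proof -
      from that have n: "3 \<le> n" and v: "14 \<le> real n"
        by simp_all
      then have "inverse (real n + 1) \<le> 1 / 15" "inverse (real n) \<le> 1 / 14" "0 \<le> inverse (real n - 1)"
        "inverse (real n - 2) \<le> 1 / 12"
        by (simp_all add: divide_simps)
      moreover have "0 \<le> (real n)\<^sup>2 - 28 * real n + 196"
        using zero_le_power2[of "real n - 14"] by (simp add: power2_diff algebra_simps)
      ultimately show ?thesis
        using v unfolding combined_numer_coeff[OF n] ring_distribs by linarith
    qed
    show "0 < horner ?es t"
      by (rule horner_pos[where bs = ?bs]) (use t in \<open>simp_all add: Let_def\<close>)
  qed simp
qed

text \<open>This ratio has to be bounded from above, hence the negative \<open>k\<close>. With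
  \<open>\<sigma> = 1\<close> the linear growth in \<open>n\<close> cancels and the coefficients
  tend to 6, so crude bounds on the inverses settle the tail.\<close>

lemma denom_bound_beta:
  assumes t: "0 < t" "t < 1"
  shows "(- 2 + (- 15 / 4) * t + 0 * t ^ 2 + (- 17 / 4) * t ^ 3) * power_series denom_coeff t <
    (- 2) * (1 - 1 * t ^ 2) * euler_series denom_coeff t"
proof -
  let ?w = "combined_coeff denom_coeff (- 2) 1 (- 2) (- 15 / 4) 0 (- 17 / 4)"
  let ?es = "[48/1000, -84/1000, 1109/1000] :: real list"
  show ?thesis
  proof (rule combined_series_pos[OF denom_coeff_bound t, where es = ?es])
    show "?es ! i \<le> ?w (i + 2)" if "i < length ?es" for i
    proof -
      have "i \<in> set [0..<3]"
        using that by simp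
      then show ?thesis
        by (simp add: upt_rec combined_coeff_def denom_coeff_def del: set_upt)
          (elim disjE, simp_all)
    qed
    show "0 \<le> ?w n" if "n \<ge> length ?es + 2" for n
    proof (cases "n < 10")
      case True
      with that have "n = 5 \<or> n = 6 \<or> n = 7 \<or> n = 8 \<or> n = 9"
        by auto
      then show ?thesis
        by (elim disjE) (simp_all add: combined_coeff_def denom_coeff_def)
    next
      case False
      then have n: "3 \<le> n" and v: "10 \<le> real n"
        by simp_all
      then have "inverse (real n + 1) \<le> 1 / 11" "inverse (real n) \<le> 1 / 10" "0 \<le> inverse (real n - 1)"
        "inverse (real n - 1) \<le> 1 / 9" "inverse (real n - 2) \<le> 1 / 8"
        by (simp_all add: divide_simps)
      moreover have "0 \<le> inverse (real n + 1) ^ 2" "0 \<le> inverse (real n) ^ 2" "0 \<le> inverse (real n - 2) ^ 2"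
        "0 \<le> inverse (real n - 1) ^ 2"
        by simp_all
      \<comment> \<open>Among the squared inverses only this one enters with a negative sign and
        needs an upper bound.\<close>
      moreover have "inverse (real n - 1) ^ 2 \<le> 1 / 81"
        using v power_mono[of "inverse (real n - 1)" "1 / 9" 2] by (simp add: divide_simps)
      ultimately show ?thesis
        using v unfolding combined_denom_coeff[OF n] ring_distribs by linarith
    qed
    show "0 < horner ?es t"
      by (rule horner_pos[where bs = "[0, 1 / 2, 1]"]) (use t in \<open>simp_all add: Let_def\<close>)
  qed simp
qed

text \<open>The coefficients again tend to 6. The truncated polynomial drops below 0.006 near 0.24,
  which is why the partition is so fine there.\<close>

lemma denom_bound_mu:
  assumes t: "0 < t" "t < 1"
  shows "(- 2 + (- 4) * t + 3 * t ^ 2 + (- 7) * t ^ 3) * power_series denom_coeff t <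
    (- 2) * (1 - 1 * t ^ 2) * euler_series denom_coeff t"
proof -
  let ?w = "combined_coeff denom_coeff (- 2) 1 (- 2) (- 4) 3 (- 7)"
  let ?es = "[111/1000, -723/1000, 604/1000, 1803/1000, 2568/1000] :: real list"
  let ?bs = "[0, 134/1000, 1814/10000, 2042/10000, 2183/10000, 2294/10000, 2403/10000, 2511/10000,
    2643/10000, 2807/10000, 3121/10000, 3857/10000, 1] :: real list"
  show ?thesis
  proof (rule combined_series_pos[OF denom_coeff_bound t, where es = ?es])
    show "?es ! i \<le> ?w (i + 2)" if "i < length ?es" for i
    proof -
      have "i \<in> set [0..<5]"
        using that by simp
      then show ?thesis
        by (simp add: upt_rec combined_coeff_def denom_coeff_def del: set_upt)
          (elim disjE, simp_all)
    qed
    show "0 \<le> ?w n" if "n \<ge> length ?es + 2" for n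
    proof -
      from that have n: "3 \<le> n" and v: "7 \<le> real n"
        by simp_all
      then have "inverse (real n + 1) \<le> 1 / 8" "inverse (real n) \<le> 1 / 7" "0 \<le> inverse (real n - 1)"
        "inverse (real n - 1) \<le> 1 / 6" "inverse (real n - 2) \<le> 1 / 5"
        by (simp_all add: divide_simps)
      moreover have "0 \<le> inverse (real n + 1) ^ 2" "0 \<le> inverse (real n) ^ 2" "0 \<le> inverse (real n - 2) ^ 2"
        "0 \<le> inverse (real n - 1) ^ 2"
        by simp_all
      moreover have "inverse (real n - 1) ^ 2 \<le> 1 / 36"
        using v power_mono[of "inverse (real n - 1)" "1 / 6" 2] by (simp add: divide_simps)
      ultimately show ?thesis
        using v unfolding combined_denom_coeff[OF n] ring_distribs by linarith
    qed
    show "0 < horner ?es t"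
      by (rule horner_pos[where bs = ?bs]) (use t in \<open>simp_all add: Let_def\<close>)
  qed simp
qed


section \<open>One-variable bounds for the ratios t a'(t) / a(t)\<close>

lemma numer_power_series_pos: "0 < t \<Longrightarrow> t < 1 \<Longrightarrow> 0 < power_series numer_coeff t"
  by (rule power_series_pos[OF numer_coeff_bound]) (auto simp: numer_coeff_def)

lemma denom_power_series_pos: "0 < t \<Longrightarrow> t < 1 \<Longrightarrow> 0 < power_series denom_coeff t"
  by (rule power_series_pos[OF denom_coeff_bound]) (auto simp: denom_coeff_def)

text \<open>Clearing positive denominators leads to \<open>numer_bound_beta\<close>. Both sides tend
  to 4 as t tends to 0, so no constant above -2 is possible here;
  \<open>denom_ratio_bound_beta\<close> likewise allows none below, and -2 is the only separating
  constant.\<close>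

lemma numer_ratio_bound_beta:
  assumes "0 < t" "t < 1"
  defines "s \<equiv> t / beta"
  shows "11 / (1 - s) - 5 / (1 + s) - 17 / 4 * s - 2 <
    4 * (euler_series numer_coeff t / power_series numer_coeff t)"
proof -
  let ?N = "power_series numer_coeff t" and ?T = "euler_series numer_coeff t"
  have N: "0 < ?N"
    using assms by (intro numer_power_series_pos)
  have s: "0 < 1 - s" "0 < 1 + s"
    using assms by (auto simp: beta_def)
  then have s2: "0 < 1 - s ^ 2"
    using mult_pos_pos[OF s] by (simp add: power2_eq_square algebra_simps)
  have "11 / (1 - s) - 5 / (1 + s) - 17 / 4 * s - 2 =
      (4 + 47 / 4 * s + 2 * s ^ 2 + 17 / 4 * s ^ 3) / ((1 - s) * (1 + s))"
    using s by (simp add: divide_simps) (simp add: algebra_simps power2_eq_square power3_eq_cube)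
  also have "(1 - s) * (1 + s) = 1 - s ^ 2"
    by (simp add: power2_eq_square algebra_simps)
  also have "(4 + 47 / 4 * s + 2 * s ^ 2 + 17 / 4 * s ^ 3) / (1 - s ^ 2) < 4 * ?T / ?N"
    using numer_bound_beta[OF assms(1,2)] N s2
    by (simp add: pos_divide_less_eq pos_less_divide_eq)
      (simp add: s_def beta_def power_mult_distrib power_divide algebra_simps)
  finally show ?thesis
    by simp
qed


text \<open>The same reduction with the constant 1; the restriction on \<open>t\<close> is inherited
  from \<open>numer_bound_mu\<close>.\<close>

lemma numer_ratio_bound_mu:
  assumes "0.21888 \<le> t" "t < 0.95"
  defines "s \<equiv> t / mu"
  shows "11 / (1 - s) - 8 / (1 + s) - 7 * s + 1 <
    4 * (euler_series numer_coeff t / power_series numer_coeff t)"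
proof -
  let ?N = "power_series numer_coeff t" and ?T = "euler_series numer_coeff t"
  have N: "0 < ?N"
    using assms by (intro numer_power_series_pos) auto
  have s: "0 < 1 - s" "0 < 1 + s"
    using assms by (auto simp: mu_def)
  then have s2: "0 < 1 - s ^ 2"
    using mult_pos_pos[OF s] by (simp add: power2_eq_square algebra_simps)
  have "11 / (1 - s) - 8 / (1 + s) - 7 * s + 1 =
      (4 + 12 * s - s ^ 2 + 7 * s ^ 3) / ((1 - s) * (1 + s))"
    using s by (simp add: divide_simps) (simp add: algebra_simps power2_eq_square power3_eq_cube)
  also have "(1 - s) * (1 + s) = 1 - s ^ 2"
    by (simp add: power2_eq_square algebra_simps)
  also have "(4 + 12 * s - s ^ 2 + 7 * s ^ 3) / (1 - s ^ 2) < 4 * ?T / ?N"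
    using numer_bound_mu[OF assms(1,2)] N s2
    by (simp add: pos_divide_less_eq pos_less_divide_eq)
      (simp add: s_def mu_def power_mult_distrib power_divide algebra_simps)
  finally show ?thesis
    by simp
qed

text \<open>The three terms added to the ratio are the contribution of the rational factor x^2
  (1+x^2) / (1-x^2)^3 to x (log f)', up to sign.\<close>

lemma denom_ratio_bound_beta:
  assumes y: "0 < y" "y < 1"
  shows "2 * (euler_series denom_coeff y / power_series denom_coeff y) + 2 + 2 * y / (1 + y) + 6 * y / (1 - y) <
    11 / (1 - y) - 5 / (1 + y) - 17 / 4 * y - 2"
proof -
  let ?D = "power_series denom_coeff y" and ?T = "euler_series denom_coeff y"
  have D: "0 < ?D"
    using y by (rule denom_power_series_pos)
  have y2: "0 < 1 - y ^ 2"
    using y by (simp add: power_less_one_iff)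
  have "2 * ?T / ?D < (2 + 15 / 4 * y + 17 / 4 * y ^ 3) / (1 - y ^ 2)"
    using denom_bound_beta[OF y] D y2
    by (simp add: pos_divide_less_eq pos_less_divide_eq) (simp add: algebra_simps)
  also have "1 - y ^ 2 = (1 - y) * (1 + y)"
    by (simp add: power2_eq_square algebra_simps)
  also have "(2 + 15 / 4 * y + 17 / 4 * y ^ 3) / ((1 - y) * (1 + y)) =
      11 / (1 - y) - 5 / (1 + y) - 17 / 4 * y - 2 - 2 - 2 * y / (1 + y) - 6 * y / (1 - y)"
    using y by (simp add: divide_simps) (simp add: algebra_simps power2_eq_square power3_eq_cube)
  finally show ?thesis
    by simp
qed

text \<open>Both sides tend to 4 as y tends to 0, so 1 is the smallest constant possible
  here.\<close>

lemma denom_ratio_bound_mu: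
  assumes y: "0 < y" "y < 1"
  shows "2 * (euler_series denom_coeff y / power_series denom_coeff y) + 2 + 2 * y / (1 + y) + 6 * y / (1 - y) <
    11 / (1 - y) - 8 / (1 + y) - 7 * y + 1"
proof -
  let ?D = "power_series denom_coeff y" and ?T = "euler_series denom_coeff y"
  have D: "0 < ?D"
    using y by (rule denom_power_series_pos)
  have y2: "0 < 1 - y ^ 2"
    using y by (simp add: power_less_one_iff)
  have "2 * ?T / ?D < (2 + 4 * y - 3 * y ^ 2 + 7 * y ^ 3) / (1 - y ^ 2)"
    using denom_bound_mu[OF y] D y2
    by (simp add: pos_divide_less_eq pos_less_divide_eq) (simp add: algebra_simps)
  also have "1 - y ^ 2 = (1 - y) * (1 + y)"
    by (simp add: power2_eq_square algebra_simps)
  also have "(2 + 4 * y - 3 * y ^ 2 + 7 * y ^ 3) / ((1 - y) * (1 + y)) =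
      11 / (1 - y) - 8 / (1 + y) - 7 * y + 1 - 2 - 2 * y / (1 + y) - 6 * y / (1 - y)"
    using y by (simp add: divide_simps) (simp add: algebra_simps power2_eq_square power3_eq_cube)
  finally show ?thesis
    by simp
qed

section \<open>Recombination into a bound for (log f)'\<close>

text \<open>The factor \<open>s - y\<close> splits both products; in the second one the sign flips,
  which turns \<open>q\<close> into \<open>- q\<close>.\<close>

lemma partial_fractions_separate:
  fixes s y :: real
  assumes "s < 1" "y < 1" "0 < s" "0 < y"
  shows "(s - y) * (p / ((1 - y) * (1 - s)) + q / ((1 + y) * (1 + s)) - r) =
    (p / (1 - s) - q / (1 + s) - r * s) - (p / (1 - y) - q / (1 + y) - r * y)"
proof -
  have "(s - y) * (p / ((1 - y) * (1 - s))) = p / (1 - s) - p / (1 - y)"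
    "(s - y) * (q / ((1 + y) * (1 + s))) = q / (1 + y) - q / (1 + s)"
    using assms by (simp_all add: divide_simps) (simp_all add: algebra_simps)
  then show ?thesis
    by (simp add: algebra_simps)
qed

text \<open>The first denominator lies between 0 and 1, so the first fraction is at least
  \<open>p\<close> and already outweighs \<open>r\<close>.\<close>

lemma bracket_pos:
  fixes s y :: real
  assumes "0 < s" "s < 1" "0 < y" "y < 1" "0 < q" "r < p"
    and "0 < p"
  shows "0 < p / ((1 - y) * (1 - s)) + q / ((1 + y) * (1 + s)) - r"
proof -
  have "(1 - y) * (1 - s) \<le> 1 * 1"
    using assms by (intro mult_mono) auto
  then have "p \<le> p / ((1 - y) * (1 - s))"
    using assms by (simp add: pos_le_divide_eq)
  moreover have "0 < q / ((1 + y) * (1 + s))"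
    using assms by simp
  ultimately show ?thesis
    using assms by linarith
qed

lemma deriv_ln_f_beta:
  assumes c: "0 < c" "c < 1" and x: "0 < x" "x < 0.9 * c"
  shows "(\<lambda>z. ln (f c z)) field_differentiable (at x)"
    and "(c / beta - x) * B_beta c x < deriv (\<lambda>z. ln (f c z)) x"
    and "0 < (c / beta - x) * B_beta c x"
proof -
  define t y s where "t = c * x" and "y = x ^ 2" and "s = t / beta"
  have "x < 1"
    using x c by simp
  have t: "0 < t" "t < 1"
    using c x \<open>x < 1\<close> mult_strict_mono[of c 1 x 1] by (auto simp: t_def)
  have y: "0 < y" "y < 1"
    using x \<open>x < 1\<close> by (auto simp: y_def power_less_one_iff)
  have s: "0 < s" "s < 1"
    using t by (auto simp: s_def beta_def)
  note d = ln_f_has_derivative[OF c x(1) \<open>x < 1\<close>, folded t_def y_def]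
  show "(\<lambda>z. ln (f c z)) field_differentiable (at x)"
    using d by (auto simp: field_differentiable_def)
  have B: "B_beta c x = 11 / ((1 - y) * (1 - s)) + 5 / ((1 + y) * (1 + s)) - 17 / 4"
    by (simp add: B_beta_def y_def s_def t_def)
  have "x * ((c / beta - x) * B_beta c x) = (s - y) * B_beta c x"
    by (simp add: s_def t_def y_def power2_eq_square algebra_simps)
  also have "\<dots> = (11 / (1 - s) - 5 / (1 + s) - 17 / 4 * s) - (11 / (1 - y) - 5 / (1 + y) - 17 / 4 * y)"
    unfolding B using s y by (intro partial_fractions_separate)
  \<comment> \<open>The constant -2 occurs in both one-variable bounds and cancels when they are
    combined.\<close>
  also have "\<dots> < 4 * (euler_series numer_coeff t / power_series numer_coeff t)
     - 2 * (euler_series denom_coeff y / power_series denom_coeff y)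
     - 2 - 2 * y / (1 + y) - 6 * y / (1 - y)"
    using numer_ratio_bound_beta[OF t, folded s_def] denom_ratio_bound_beta[OF y] by linarith
  also have "\<dots> = x * deriv (\<lambda>z. ln (f c z)) x"
    using DERIV_imp_deriv[OF d] x by simp
  finally show "(c / beta - x) * B_beta c x < deriv (\<lambda>z. ln (f c z)) x"
    using x by simp
  have "0 < B_beta c x"
    unfolding B using s y by (intro bracket_pos) auto
  then show "0 < (c / beta - x) * B_beta c x"
    using x by (simp add: beta_def)
qed

text \<open>The argument is that for \<beta> with separating constant 1. Here
  \<open>0.95 * c\<close> is \<open>c / mu\<close>, and the lower bound on \<open>c * x\<close> is
  what \<open>numer_bound_mu\<close> requires.\<close>

lemma deriv_ln_f_mu:
  assumes c: "0 < c" "c < 1" and x: "0 < x" "x < 0.95 * c" "0.21888 \<le> c * x"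
  shows "(\<lambda>z. ln (f c z)) field_differentiable (at x)"
    and "(c / mu - x) * B_mu c x < deriv (\<lambda>z. ln (f c z)) x"
    and "0 < (c / mu - x) * B_mu c x"
proof -
  define t y s where "t = c * x" and "y = x ^ 2" and "s = t / mu"
  have x1: "x < 0.95"
    using x c by simp
  then have "x < 1"
    by simp
  have t: "0.21888 \<le> t" "t < 0.95"
    using c x x1 mult_strict_mono[of c 1 x "0.95"] by (auto simp: t_def)
  have y: "0 < y" "y < 1"
    using x \<open>x < 1\<close> by (auto simp: y_def power_less_one_iff)
  have s: "0 < s" "s < 1"
    using t by (auto simp: s_def mu_def)
  note d = ln_f_has_derivative[OF c x(1) \<open>x < 1\<close>, folded t_def y_def]
  show "(\<lambda>z. ln (f c z)) field_differentiable (at x)"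
    using d by (auto simp: field_differentiable_def)
  have B: "B_mu c x = 11 / ((1 - y) * (1 - s)) + 8 / ((1 + y) * (1 + s)) - 7"
    by (simp add: B_mu_def y_def s_def t_def mult.commute)
  have "x * ((c / mu - x) * B_mu c x) = (s - y) * B_mu c x"
    by (simp add: s_def t_def y_def power2_eq_square algebra_simps)
  also have "\<dots> = (11 / (1 - s) - 8 / (1 + s) - 7 * s) - (11 / (1 - y) - 8 / (1 + y) - 7 * y)"
    unfolding B using s y by (intro partial_fractions_separate)
  also have "\<dots> < 4 * (euler_series numer_coeff t / power_series numer_coeff t)
     - 2 * (euler_series denom_coeff y / power_series denom_coeff y)
     - 2 - 2 * y / (1 + y) - 6 * y / (1 - y)"
    using numer_ratio_bound_mu[OF t, folded s_def] denom_ratio_bound_mu[OF y] by linarith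
  also have "\<dots> = x * deriv (\<lambda>z. ln (f c z)) x"
    using DERIV_imp_deriv[OF d] x by simp
  finally show "(c / mu - x) * B_mu c x < deriv (\<lambda>z. ln (f c z)) x"
    using x by simp
  have "0 < B_mu c x"
    unfolding B using s y by (intro bracket_pos) auto
  then show "0 < (c / mu - x) * B_mu c x"
    using x by (simp add: mu_def)
qed

section \<open>Monotonicity of f and the final result\<close>

lemma f_pos:
  assumes c: "0 < c" "c < 1" and x: "0 < x" "x < 1"
  shows "0 < f c x"
proof -
  have t: "0 < c * x" "c * x < 1"
    using c x mult_strict_mono[of c 1 x 1] by auto
  have y: "0 < x ^ 2" "x ^ 2 < 1"
    using x by (auto simp: power_less_one_iff)
  have "0 < numer_series c x" "0 < denom_series x"
    using t y x numer_power_series_pos[OF t] denom_power_series_pos[OF y]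
    by (simp_all add: numer_series_eq denom_series_eq)
  then show ?thesis
    unfolding f_def using x y by (intro divide_pos_pos mult_pos_pos zero_less_power add_pos_pos) auto
qed

text \<open>The logarithm of f increases by the sign of its derivative, and positivity of f allows
  the logarithm to be removed.\<close>

lemma f_strict_mono_onI:
  assumes c: "0 < c" "c < 1" and "0 \<le> a" "b \<le> 1"
    and diff: "\<And>x. x \<in> {a <..< b} \<Longrightarrow> (\<lambda>z. ln (f c z)) field_differentiable (at x)"
    and pos: "\<And>x. x \<in> {a <..< b} \<Longrightarrow> 0 < deriv (\<lambda>z. ln (f c z)) x"
  shows "strict_mono_on {a <..< b} (f c)"
proof (rule strict_mono_onI)
  fix x y
  assume xy: "x \<in> {a <..< b}" "y \<in> {a <..< b}" "x < y"
  have "ln (f c x) < ln (f c y)"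
  proof (rule DERIV_pos_imp_increasing[OF \<open>x < y\<close>])
    fix z
    assume "x \<le> z" "z \<le> y"
    with xy have z: "z \<in> {a <..< b}"
      by auto
    then show "\<exists>d. ((\<lambda>z. ln (f c z)) has_real_derivative d) (at z) \<and> 0 < d"
      using diff pos field_differentiable_derivI by blast
  qed
  moreover have "0 < f c x" "0 < f c y"
    using xy assms(3,4) by (auto intro!: f_pos c)
  ultimately show "f c x < f c y"
    by simp
qed

theorem theorem2:
  fixes c :: real
  assumes "0.005 < c" and "c < 1"
  shows "(\<forall>x \<in> I_beta c.
            (\<lambda>y. ln (f c y)) field_differentiable (at x) \<and>
            deriv (\<lambda>y. ln (f c y)) x > (c / beta - x) * B_beta c x \<and>
            (c / beta - x) * B_beta c x > 0)
       \<and> (0.5 \<le> c \<longrightarrow>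
          (\<forall>x \<in> I_mu c.
            (\<lambda>y. ln (f c y)) field_differentiable (at x) \<and>
            deriv (\<lambda>y. ln (f c y)) x > (c / mu - x) * B_mu c x \<and>
            (c / mu - x) * B_mu c x > 0))
       \<and> (c < 0.5 \<longrightarrow> strict_mono_on {0.0045 <..< 0.9 * c} (f c))
       \<and> (0.5 \<le> c \<longrightarrow> strict_mono_on {0.0045 <..< 0.95 * c} (f c))"
proof -
  have c: "0 < c" "c < 1"
    using assms by auto
  have split: "0.48 ^ 2 / (c * mu) = 0.21888 / c"
    by (simp add: mu_def power2_eq_square)
  have beta: "0 < x" "x < 0.9 * c" if "x \<in> I_beta c" for x
  proof -
    show "0 < x"
      using that by (auto simp: I_beta_def split: if_splits)
    show "x < 0.9 * c"
    proof (cases "c < 0.5")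
      case False
      \<comment> \<open>For \<open>c \<ge> 0.5\<close> the right end of \<open>I_beta c\<close> is
        at most 0.43776, hence below 0.45 and so below \<open>0.9 * c\<close>.\<close>
      then have "0.21888 / c < 0.9 * 0.5"
        using c by (simp add: divide_simps)
      moreover have "x \<le> 0.21888 / c"
        using that False unfolding I_beta_def split by auto
      ultimately show ?thesis
        using False by simp
    qed (use that in \<open>auto simp: I_beta_def\<close>)
  qed
  have mu: "0 < x" "x < 0.95 * c" "0.21888 \<le> c * x" if "x \<in> I_mu c" for x
  proof -
    have "0.21888 / c < x" "x < 0.95 * c"
      using that unfolding I_mu_def split by auto
    moreover have "0 < 0.21888 / c"
      using c by simp
    ultimately show "0 < x" "x < 0.95 * c"
      by linarith+
    show "0.21888 \<le> c * x"
      using \<open>0.21888 / c < x\<close> pos_divide_less_eq[OF c(1), of "0.21888" x] by (simp only: mult.commute[of c x] less_imp_le)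
  qed
  \<comment> \<open>Every fact of \<open>beta\<close> and \<open>mu\<close> carries its own
    membership premise, so the rules in \<open>b\<close> have it twice and those in \<open>m\<close>
    three times.\<close>
  note b = deriv_ln_f_beta[OF c beta] and m = deriv_ln_f_mu[OF c mu]
  have "strict_mono_on {0.0045 <..< 0.9 * c} (f c)" if "c < 0.5"
  proof (rule f_strict_mono_onI[OF c])
    fix x
    assume "x \<in> {0.0045 <..< 0.9 * c}"
    then have "x \<in> I_beta c"
      using that by (simp add: I_beta_def)
    from b[OF this this] show "(\<lambda>z. ln (f c z)) field_differentiable (at x)"
      "0 < deriv (\<lambda>z. ln (f c z)) x"
      by auto
  qed (use c in auto)
  moreover have "strict_mono_on {0.0045 <..< 0.95 * c} (f c)" if "0.5 \<le> c"
  proof (rule f_strict_mono_onI[OF c])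
    fix x
    assume "x \<in> {0.0045 <..< 0.95 * c}"
    \<comment> \<open>The two intervals cover the range because \<open>I_beta c\<close> includes the
      point at which \<open>I_mu c\<close> starts.\<close>
    then have "x \<in> I_beta c \<or> x \<in> I_mu c"
      using that by (auto simp: I_beta_def I_mu_def)
    then show "(\<lambda>z. ln (f c z)) field_differentiable (at x)" "0 < deriv (\<lambda>z. ln (f c z)) x"
      using b m less_trans by blast+
  qed (use c in auto)
  ultimately show ?thesis
    using b m by blast
qed

end
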